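(* Let $1<p<\infty$ and $0<\gamma<1$ be such that $\gamma p<1$. Then there is a constant $C>0$ such that $$\mathcal{C}_{\gamma,p}(B(x,r))\le C\,\mu(B(x,r))^{1-\gamma p}$$ for every ball $B(x,r)$ in $X$.
   Context: Setting: $X=(X,d,\mu)$ is a locally compact metric space equipped with a Borel regular outer measure $\mu$ that is doubling, i.e. there is a constant $c_d\ge 1$ with $\mu(B(x,2r))\le c_d\,\mu(B(x,r))$ for every ball $B(x,r)=\{y\in X: d(y,x)<r\}$. Every open ball has positive and finite measure. Spheres have measure zero, $\mu(\{y\in X: d(x,y)=r\})=0$ for all $x\in X$, $r>0$, and points have measure zero, $\mu(\{x\})=0$ for all $x\in X$. For $0<\gamma<1$, the Riesz potential of order $\gamma$ of a measurable function $f$ is $$I_\gamma f(x)=\int_X \frac{f(y)}{\mu(B(x,d(x,y)))^{1-\gamma}}\,d\mu(y)$$ (the single point $y=x$ may be omitted from the domain of integration, since it is $\mu$-null). $L^p_+(X)$ denotes the set of non-negative functions in $L^p(X)=L^p(X,\mu)$. For $1<p<\infty$ and any $E\subset X$, the Riesz $(\gamma,p)$-capacity is $\mathcal{C}_{\gamma,p}(E)=\inf_{f\in\mathcal{A}(E)}\|f\|_{L^p(X)}^p$, where $\mathcal{A}(E)=\{f\in L^p_+(X): I_\gamma f\ge 1\text{ on }E\}$ and $\mathcal{C}_{\gamma,p}(E)=\infty$ if $\mathcal{A}(E)=\emptyset$. The constant $C$ does not depend on $x$ and $r$. *)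

theory Defs
  imports "HOL-Analysis.Analysis"
begin

definition borel_regular_outer_measure :: "('a::topological_space set \<Rightarrow> ennreal) \<Rightarrow> bool" where
  "borel_regular_outer_measure \<mu> \<longleftrightarrow>
     outer_measure_space UNIV \<mu> \<and>
     sets borel \<subseteq> lambda_system UNIV UNIV \<mu> \<and>
     (\<forall>A. \<exists>B\<in>sets borel. A \<subseteq> B \<and> \<mu> B = \<mu> A)"

(* "Measurable" means Caratheodory measurable with respect to the outer measure;
   this is the measure that functions are integrated against. *)
definition caratheodory_measure :: "('a set \<Rightarrow> ennreal) \<Rightarrow> 'a measure" where
  "caratheodory_measure \<mu> = measure_of UNIV (lambda_system UNIV UNIV \<mu>) \<mu>"

lemma measure_space_caratheodory:
  "outer_measure_space UNIV \<mu> \<Longrightarrow> measure_space UNIV (lambda_system UNIV UNIV \<mu>) \<mu>"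
  using sigma_algebra.caratheodory_lemma[OF sigma_algebra_Pow, of UNIV \<mu>] by simp

lemma space_caratheodory_measure [simp]: "space (caratheodory_measure \<mu>) = UNIV"
  by (simp add: caratheodory_measure_def space_measure_of_conv)

lemma sets_caratheodory_measure:
  "outer_measure_space UNIV \<mu> \<Longrightarrow>
     sets (caratheodory_measure \<mu>) = lambda_system UNIV UNIV \<mu>"
  using measure_space_caratheodory[of \<mu>]
  by (simp add: caratheodory_measure_def measure_space_def sigma_algebra.sigma_sets_eq)

lemma emeasure_caratheodory_measure:
  assumes "outer_measure_space UNIV \<mu>" "A \<in> lambda_system UNIV UNIV \<mu>"
  shows "emeasure (caratheodory_measure \<mu>) A = \<mu> A"
  using measure_space_caratheodory[OF assms(1)] assms(2)
  unfolding caratheodory_measure_def measure_space_def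
  by (intro emeasure_measure_of_sigma) auto

definition doubling :: "('a::metric_space set \<Rightarrow> ennreal) \<Rightarrow> bool" where
  "doubling \<mu> \<longleftrightarrow>
     (\<exists>c::real. c \<ge> 1 \<and> (\<forall>x r. r > 0 \<longrightarrow> \<mu> (ball x (2 * r)) \<le> ennreal c * \<mu> (ball x r)))"

(* Only applied to non-negative f, so the value is an element of [0, \<infinity>].  Omitting y = x
   avoids the spurious quotient by \<mu> (ball x 0) = 0. *)
definition riesz_potential ::
    "('a::metric_space set \<Rightarrow> ennreal) \<Rightarrow> real \<Rightarrow> ('a \<Rightarrow> real) \<Rightarrow> 'a \<Rightarrow> ennreal" where
  "riesz_potential \<mu> \<gamma> f x =
     (\<integral>\<^sup>+y\<in>-{x}. ennreal (f y / enn2real (\<mu> (ball x (dist x y))) powr (1 - \<gamma>))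
        \<partial>caratheodory_measure \<mu>)"

definition Lp_norm :: "'a measure \<Rightarrow> real \<Rightarrow> ('a \<Rightarrow> real) \<Rightarrow> real" where
  "Lp_norm M p f = (\<integral>y. \<bar>f y\<bar> powr p \<partial>M) powr (1 / p)"

(* Real-valued representatives suffice: modifying f on a null set changes neither its norm
   nor its Riesz potential at any point. *)
definition Lp_nonneg :: "'a measure \<Rightarrow> real \<Rightarrow> ('a \<Rightarrow> real) set" where
  "Lp_nonneg M p = {f \<in> borel_measurable M. integrable M (\<lambda>y. \<bar>f y\<bar> powr p) \<and> (\<forall>y. f y \<ge> 0)}"

definition admissible ::
    "('a::metric_space set \<Rightarrow> ennreal) \<Rightarrow> real \<Rightarrow> real \<Rightarrow> 'a set \<Rightarrow> ('a \<Rightarrow> real) set" where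
  "admissible \<mu> \<gamma> p E =
     {f \<in> Lp_nonneg (caratheodory_measure \<mu>) p. \<forall>x\<in>E. riesz_potential \<mu> \<gamma> f x \<ge> 1}"

(* The infimum over an empty admissible class is \<infinity>. *)
definition riesz_capacity ::
    "('a::metric_space set \<Rightarrow> ennreal) \<Rightarrow> real \<Rightarrow> real \<Rightarrow> 'a set \<Rightarrow> ennreal" where
  "riesz_capacity \<mu> \<gamma> p E =
     (INF f\<in>admissible \<mu> \<gamma> p E. ennreal (Lp_norm (caratheodory_measure \<mu>) p f powr p))"

end

theory Submission
  imports Defs
begin

text \<open>
  A constant multiple of the indicator of \<open>B = ball x r\<close> is a good enough competitor. For
  distinct \<open>y, z \<in> B\<close> the ball \<open>ball y (dist y z)\<close> lies in \<open>ball x (4 * r)\<close>, so doubling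
  twice bounds its measure by \<open>D = c\<^sup>2 * \<mu> B\<close>. As \<open>\<gamma> < 1\<close>, the Riesz kernel is therefore at
  least \<open>D powr (\<gamma> - 1)\<close> on \<open>B \<times> B\<close> off the diagonal, and the function with value
  \<open>K = D powr (1 - \<gamma>) / \<mu> B\<close> on \<open>B\<close> and \<open>0\<close> elsewhere has potential at least
  \<open>1\<close> on \<open>B\<close>; deleting the centre point from the domain of integration costs nothing because
  points are null. The \<open>p\<close>-th power of its norm is \<open>K powr p * \<mu> B\<close>, in which the powers of
  \<open>\<mu> B\<close> collect to \<open>(1 - \<gamma>) * p - p + 1 = 1 - \<gamma> * p\<close>, so
  \<open>C = c powr (2 * (1 - \<gamma>) * p)\<close> works for every ball.
\<close>

lemma doubling_enn2real:
  fixes \<mu> :: "'a::metric_space set \<Rightarrow> ennreal"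
  assumes "doubling \<mu>"
    and fin: "\<And>x r. r > 0 \<Longrightarrow> \<mu> (ball x r) < \<infinity>"
  obtains c :: real where "c \<ge> 1"
    and "\<And>x r. r > 0 \<Longrightarrow> enn2real (\<mu> (ball x (2 * r))) \<le> c * enn2real (\<mu> (ball x r))"
proof -
  obtain c :: real where c: "c \<ge> 1"
    and le: "\<And>x r. r > 0 \<Longrightarrow> \<mu> (ball x (2 * r)) \<le> ennreal c * \<mu> (ball x r)"
    using assms(1) unfolding doubling_def by blast
  have "enn2real (\<mu> (ball x (2 * r))) \<le> c * enn2real (\<mu> (ball x r))" if "r > 0" for x :: 'a and r
  proof -
    have "enn2real (\<mu> (ball x (2 * r))) \<le> enn2real (ennreal c * \<mu> (ball x r))"
      using le[OF that, of x] fin[OF that, of x]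
      by (intro enn2real_mono) (auto simp: ennreal_mult_less_top)
    then show ?thesis
      using c by (simp add: enn2real_mult)
  qed
  with c show thesis
    using that by blast
qed

text \<open>
  Off the diagonal the Riesz kernel on \<open>ball x r\<close> is bounded below by its value at the scale
  of the whole ball, since \<open>ball y (dist y z)\<close> is contained in \<open>ball x (2 * (2 * r))\<close>.
\<close>

lemma measure_ball_dist_le:
  fixes \<mu> :: "'a::metric_space set \<Rightarrow> ennreal"
  assumes mono: "\<And>A B. A \<subseteq> B \<Longrightarrow> \<mu> A \<le> \<mu> B"
    and fin: "\<And>x r. r > 0 \<Longrightarrow> \<mu> (ball x r) < \<infinity>"
    and c: "c \<ge> 1"
    and dbl: "\<And>x r. r > 0 \<Longrightarrow> enn2real (\<mu> (ball x (2 * r))) \<le> c * enn2real (\<mu> (ball x r))"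
    and yz: "y \<in> ball x r" "z \<in> ball x r"
  shows "enn2real (\<mu> (ball y (dist y z))) \<le> c\<^sup>2 * enn2real (\<mu> (ball x r))"
proof -
  have r: "r > 0"
    using yz(1) by (metis ball_eq_empty empty_iff not_le)
  have "ball y (dist y z) \<subseteq> ball x (2 * (2 * r))"
  proof
    fix w assume "w \<in> ball y (dist y z)"
    then show "w \<in> ball x (2 * (2 * r))"
      using yz dist_triangle[of x w y] dist_triangle[of y z x] r
      by (simp add: dist_commute)
  qed
  then have "enn2real (\<mu> (ball y (dist y z))) \<le> enn2real (\<mu> (ball x (2 * (2 * r))))"
    using mono fin[of "2 * (2 * r)" x] r by (intro enn2real_mono) auto
  also have "\<dots> \<le> c * enn2real (\<mu> (ball x (2 * r)))"
    using dbl[of "2 * r" x] r by simp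
  also have "\<dots> \<le> c * (c * enn2real (\<mu> (ball x r)))"
    using dbl[OF r, of x] c by (intro mult_left_mono) auto
  finally show ?thesis
    by (simp add: power2_eq_square mult.assoc)
qed

lemma emeasure_caratheodory_borel:
  assumes "borel_regular_outer_measure \<mu>" and "A \<in> sets borel"
  shows "A \<in> sets (caratheodory_measure \<mu>)"
    and "emeasure (caratheodory_measure \<mu>) A = \<mu> A"
  using assms unfolding borel_regular_outer_measure_def
  by (auto simp: sets_caratheodory_measure intro!: emeasure_caratheodory_measure)

text \<open>
  The constant in front of the indicator is the one for which the integrand is at least
  \<open>1 / m\<close> on \<open>B - {y}\<close>, a set of measure \<open>m\<close>. Positivity of \<open>\<mu>\<close> on balls rules out the
  default value \<open>a / 0 = 0\<close> in the kernel.
\<close>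

lemma riesz_potential_indicator_ge_1:
  fixes \<mu> :: "'a::metric_space set \<Rightarrow> ennreal"
  assumes reg: "borel_regular_outer_measure \<mu>"
    and pos: "\<And>x r. r > 0 \<Longrightarrow> 0 < \<mu> (ball x r) \<and> \<mu> (ball x r) < \<infinity>"
    and null: "\<mu> {y} = 0"
    and B: "B \<in> sets borel" "\<mu> B = ennreal m" "m > 0"
    and "\<gamma> \<le> 1"
    and le: "\<And>z. z \<in> B \<Longrightarrow> enn2real (\<mu> (ball y (dist y z))) \<le> D"
  shows "riesz_potential \<mu> \<gamma> (\<lambda>z. D powr (1 - \<gamma>) / m * indicator B z) y \<ge> 1"
proof -
  let ?M = "caratheodory_measure \<mu>"
  note car = emeasure_caratheodory_borel[OF reg]
  have "{y} \<in> null_sets ?M"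
    using car[of "{y}"] null by auto
  then have eB: "emeasure ?M (B - {y}) = ennreal m"
    using car[OF B(1)] B(2) emeasure_Diff_null_set by metis
  have kernel: "1 / m \<le> D powr (1 - \<gamma>) / m / enn2real (\<mu> (ball y (dist y z))) powr (1 - \<gamma>)"
    if z: "z \<in> B - {y}" for z
  proof -
    let ?d = "enn2real (\<mu> (ball y (dist y z)))"
    have d: "?d > 0"
      using pos[of "dist y z" y] z by (auto simp: enn2real_positive_iff)
    have "?d powr (1 - \<gamma>) \<le> D powr (1 - \<gamma>)"
      using d le[of z] z \<open>\<gamma> \<le> 1\<close> by (intro powr_mono2) auto
    then show ?thesis
      using d B(3) by (simp add: field_simps)
  qed
  have "1 = ennreal (1 / m) * emeasure ?M (B - {y})"
    using B(3) by (simp add: eB flip: ennreal_mult)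
  also have "\<dots> = (\<integral>\<^sup>+z. ennreal (1 / m) * indicator (B - {y}) z \<partial>?M)"
    using car(1)[OF B(1)] car(1)[of "{y}"] by (simp add: nn_integral_cmult_indicator)
  also have "\<dots> \<le> riesz_potential \<mu> \<gamma> (\<lambda>z. D powr (1 - \<gamma>) / m * indicator B z) y"
    unfolding riesz_potential_def
    using kernel by (intro nn_integral_mono) (auto simp: indicator_def intro!: ennreal_leI)
  finally show ?thesis .
qed

lemma
  assumes A: "A \<in> sets M" "emeasure M A = ennreal m" "m > 0" and "K > 0" and "p > 0"
  shows scaled_indicator_in_Lp_nonneg: "(\<lambda>y. K * indicator A y) \<in> Lp_nonneg M p"
    and Lp_norm_scaled_indicator: "Lp_norm M p (\<lambda>y. K * indicator A y) powr p = K powr p * m"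
proof -
  have eq: "(\<lambda>y. \<bar>K * indicator A y\<bar> powr p) = (\<lambda>y. K powr p * indicator A y)"
    using assms by (auto simp: indicator_def)
  have int: "integrable M (\<lambda>y. K powr p * indicator A y :: real)"
    using A by (intro integrable_mult_right integrable_real_indicator) auto
  have meas: "(\<lambda>y. K * indicator A y :: real) \<in> borel_measurable M"
    using A by measurable
  show "(\<lambda>y. K * indicator A y) \<in> Lp_nonneg M p"
    using meas int \<open>K > 0\<close> unfolding Lp_nonneg_def mem_Collect_eq eq by simp
  have "(\<integral>y. \<bar>K * indicator A y\<bar> powr p \<partial>M) = K powr p * m"
    using A sets.sets_into_space[OF A(1)] unfolding eq
    by (simp add: measure_def Int_absorb2)
  then show "Lp_norm M p (\<lambda>y. K * indicator A y) powr p = K powr p * m"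
    using assms unfolding Lp_norm_def by (simp add: powr_powr)
qed

theorem lemma4p1:
  fixes \<mu> :: "'a::metric_space set \<Rightarrow> ennreal" and \<gamma> p :: real
  assumes "locally_compact_space (euclidean :: 'a topology)"
    and "borel_regular_outer_measure \<mu>"
    and "doubling \<mu>"
    and "\<And>x r. r > 0 \<Longrightarrow> 0 < \<mu> (ball x r) \<and> \<mu> (ball x r) < \<infinity>"
    and "\<And>x r. r > 0 \<Longrightarrow> \<mu> (sphere x r) = 0"
    and "\<And>x. \<mu> {x} = 0"
    and "1 < p" and "0 < \<gamma>" and "\<gamma> < 1" and "\<gamma> * p < 1"
  shows "\<exists>C::real. C > 0 \<and>
           (\<forall>x r. r > 0 \<longrightarrow>
              riesz_capacity \<mu> \<gamma> p (ball x r)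
                \<le> ennreal (C * enn2real (\<mu> (ball x r)) powr (1 - \<gamma> * p)))"
proof -
  let ?M = "caratheodory_measure \<mu>"
  have mono: "\<mu> A \<le> \<mu> B" if "A \<subseteq> B" for A B
    using assms(2) that
    unfolding borel_regular_outer_measure_def outer_measure_space_def increasing_def by auto
  obtain c :: real where c: "c \<ge> 1"
    and dbl: "\<And>x r. r > 0 \<Longrightarrow> enn2real (\<mu> (ball x (2 * r))) \<le> c * enn2real (\<mu> (ball x r))"
    using doubling_enn2real[OF assms(3)] assms(4) by blast
  define C where "C = c powr (2 * (1 - \<gamma>) * p)"
  have "riesz_capacity \<mu> \<gamma> p (ball x r)
          \<le> ennreal (C * enn2real (\<mu> (ball x r)) powr (1 - \<gamma> * p))" if r: "r > 0" for x r
  proof -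
    let ?B = "ball x r"
    define m where "m = enn2real (\<mu> ?B)"
    define D where "D = c\<^sup>2 * m"
    define K where "K = D powr (1 - \<gamma>) / m"
    define f where "f = (\<lambda>z. K * indicator ?B z)"
    have m: "m > 0" "\<mu> ?B = ennreal m"
      using assms(4)[OF r, of x] by (auto simp: m_def enn2real_positive_iff)
    have K: "K > 0"
      using m c by (simp add: K_def D_def)
    have B: "?B \<in> sets ?M" "emeasure ?M ?B = ennreal m"
      using emeasure_caratheodory_borel[OF assms(2), of ?B] m by auto
    have "riesz_potential \<mu> \<gamma> f y \<ge> 1" if y: "y \<in> ?B" for y
      unfolding f_def K_def
    proof (rule riesz_potential_indicator_ge_1)
      show "enn2real (\<mu> (ball y (dist y z))) \<le> D" if "z \<in> ?B" for z
        unfolding D_def m_def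
        using measure_ball_dist_le[OF mono _ c dbl y that] assms(4) by blast
    qed (use assms m in auto)
    then have "f \<in> admissible \<mu> \<gamma> p ?B"
      using scaled_indicator_in_Lp_nonneg[OF B m(1) K, of p] assms(7)
      by (auto simp: admissible_def f_def)
    then have "riesz_capacity \<mu> \<gamma> p ?B \<le> ennreal (Lp_norm ?M p f powr p)"
      unfolding riesz_capacity_def by (rule INF_lower)
    also have "Lp_norm ?M p f powr p = K powr p * m"
      using Lp_norm_scaled_indicator[OF B m(1) K, of p] assms(7) by (simp add: f_def)
    also have "K powr p * m = C * m powr (1 - \<gamma> * p)"
    proof -
      have "K = c powr (2 * (1 - \<gamma>)) * m powr (- \<gamma>)"
      proof -
        have "(c\<^sup>2) powr (1 - \<gamma>) = (c powr 2) powr (1 - \<gamma>)"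
          using c by simp
        also have "\<dots> = c powr (2 * (1 - \<gamma>))"
          by (rule powr_powr)
        finally have "D powr (1 - \<gamma>) = c powr (2 * (1 - \<gamma>)) * m powr (1 - \<gamma>)"
          using c m by (simp add: D_def powr_mult)
        then show ?thesis
          using m by (simp add: K_def powr_diff powr_minus field_simps)
      qed
      then have "K powr p = C * m powr (- (\<gamma> * p))"
        using c m by (simp add: C_def powr_mult powr_powr)
      then show ?thesis
        using m by (simp add: powr_diff powr_minus field_simps)
    qed
    finally show ?thesis
      by (simp add: m_def)
  qed
  moreover have "C > 0"
    using c by (simp add: C_def)
  ultimately show ?thesis
    by blast
qed

end
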